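(* For any positive integers $n, s, t$ such that $n \geq 10$, $s, t \geq 2$ and $n-1 \geq s+t$, there exists a string C-group $(G,\{\rho_0,\rho_1,\rho_2\})$ of rank $3$ with $|G| = 2^n$ and Schläfli type $\{2^s, 2^t\}$.
   Context: A string C-group of rank $3$ is a pair $(G,\{\rho_0,\rho_1,\rho_2\})$ where $G$ is a group generated by the three involutions $\rho_0,\rho_1,\rho_2$ such that $\rho_0\rho_2=\rho_2\rho_0$ (string property) and, writing $G_I=\langle \rho_i : i\in I\rangle$ for $I\subseteq\{0,1,2\}$, one has $G_I\cap G_J=G_{I\cap J}$ for all $I,J\subseteq\{0,1,2\}$ (intersection property). Its order is $|G|$. Its (Schläfli) type is $\{p_1,p_2\}$ where $p_1$ is the order of $\rho_0\rho_1$ and $p_2$ is the order of $\rho_1\rho_2$. *)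

theory Defs
  imports "HOL-Algebra.Generated_Groups" "HOL-Algebra.Multiplicative_Group"
begin

(* The generators are given as a function on the index set {0, 1, 2};
   the values of rho outside this set play no role. *)
locale string_C_group_rank3 = group G for G (structure) +
  fixes \<rho> :: "nat \<Rightarrow> 'a"
  assumes generators_closed: "\<rho> ` {0, 1, 2} \<subseteq> carrier G"
    and involutions: "i \<in> {0, 1, 2} \<Longrightarrow> ord (\<rho> i) = 2"
    and generates: "generate G (\<rho> ` {0, 1, 2}) = carrier G"
    and string_property: "\<rho> 0 \<otimes> \<rho> 2 = \<rho> 2 \<otimes> \<rho> 0"
    and intersection_property:
      "\<lbrakk>I \<subseteq> {0, 1, 2}; J \<subseteq> {0, 1, 2}\<rbrakk> \<Longrightarrow>
         generate G (\<rho> ` I) \<inter> generate G (\<rho> ` J) = generate G (\<rho> ` (I \<inter> J))"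

definition schlafli_type :: "('a, 'b) monoid_scheme \<Rightarrow> (nat \<Rightarrow> 'a) \<Rightarrow> nat \<times> nat" where
  "schlafli_type G \<rho> =
     (group.ord G (\<rho> 0 \<otimes>\<^bsub>G\<^esub> \<rho> 1), group.ord G (\<rho> 1 \<otimes>\<^bsub>G\<^esub> \<rho> 2))"

end

theory Submission
  imports Defs "HOL-Algebra.Group_Action" "HOL-Algebra.Weak_Morphisms"
    "HOL-Computational_Algebra.Primes"
begin

text \<open>Let D(m) be the dihedral group of order 2m, and put p = 2^s and q = 2^t. Suppose that G is
  generated by involutions \<rho>0, \<rho>1, \<rho>2, where \<rho>0 and \<rho>2 commute and the orders of \<rho>0 \<rho>1 and
  \<rho>1 \<rho>2 divide p and q, and that G maps to D(p)
  with \<rho>2 in the kernel and to D(q) with \<rho>0 in the kernel, the other generators going to standard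
  reflections. Each map is faithful on the dihedral subgroup generated by the two generators that
  it does not kill, and this forces the intersection property.

  The image of G in D(p) \<times> D(q) has order at most 2pq = 2^(s + t + 1). Hence, if G is a 2-group of
  larger order, the common kernel of both maps is a nontrivial normal subgroup and contains a central
  involution of G; factoring it out halves the order and preserves the hypotheses. So it suffices
  to find such 2-groups of arbitrarily large order, and these are obtained as subgroups of
  D(p) \<times> D(q) \<times> H, where H contains the groups of toroidal maps of type {4, 4}.\<close>

section \<open>Groups generated by involutions\<close>

text \<open>An involution is its own inverse, so every element of the generated subgroup is a
  product of generators and can be built by appending them on the right one at a time.\<close>

lemma (in group) generate_involutions_induct [consumes 1, case_names subset square one step]:
  assumes z: "z \<in> generate G X"
    and X: "X \<subseteq> carrier G" and sq: "\<And>x. x \<in> X \<Longrightarrow> x \<otimes> x = \<one>"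
    and one: "P \<one>" and step: "\<And>y x. \<lbrakk>y \<in> carrier G; P y; x \<in> X\<rbrakk> \<Longrightarrow> P (y \<otimes> x)"
  shows "P z"
proof -
  \<comment> \<open>\<open>generate.induct\<close> multiplies two arbitrary elements, so the claim
    needs a prefix \<open>y\<close>: appending \<open>h1 \<otimes> h2\<close> means appending
    \<open>h1\<close> and then \<open>h2\<close>.\<close>
  have "y \<in> carrier G \<Longrightarrow> P y \<Longrightarrow> P (y \<otimes> z)" for y
    using z
  proof (induction arbitrary: y rule: generate.induct)
    case (inv h)
    then have "inv h = h" using X sq by (metis inv_equality subsetD)
    then show ?case using inv step by simp
  next
    case (eng h1 h2)
    then have c: "h1 \<in> carrier G" "h2 \<in> carrier G" using generate_in_carrier[OF X] by auto
    have "P ((y \<otimes> h1) \<otimes> h2)" using eng c by simp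
    then show ?case using c eng.prems by (simp add: m_assoc)
  qed (use step in auto)
  from this[of \<one>] one show ?thesis using generate_in_carrier[OF X z] by simp
qed

lemma (in group) generate_two_involutions:
  assumes x: "x \<in> generate G {a, b}" and ab: "a \<in> carrier G" "b \<in> carrier G"
    and sq: "a \<otimes> a = \<one>" "b \<otimes> b = \<one>" and pow: "(a \<otimes> b) [^] (p::nat) = \<one>" and p: "p > 0"
  shows "\<exists>k::nat. x = (a \<otimes> b) [^] k \<or> x = (a \<otimes> b) [^] k \<otimes> a"
  using x
proof (induction rule: generate_involutions_induct)
  case one
  show ?case by (rule exI[of _ 0]) simp
next
  case (step y x)
  have ca: "(a \<otimes> b) [^] k \<in> carrier G" for k :: nat using ab by simp
  from step.IH obtain k :: nat where k: "y = (a \<otimes> b) [^] k \<or> y = (a \<otimes> b) [^] k \<otimes> a" by blast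
  consider "x = a" | "x = b" using step.hyps by blast
  then show ?case
  proof cases
    case 1
    then have "y \<otimes> x = (a \<otimes> b) [^] k \<otimes> a \<or> y \<otimes> x = (a \<otimes> b) [^] k"
      using k ab sq ca by (auto simp: m_assoc)
    then show ?thesis by blast
  next
    case 2
    \<comment> \<open>Appending \<open>b\<close> to a rotation lowers its exponent by one and leaves
      \<open>a\<close>; the relation lets \<open>k - 1\<close> be written as the natural number
      \<open>k + (p - 1)\<close>.\<close>
    have "(a \<otimes> b) [^] k = (a \<otimes> b) [^] (k + (p - 1)) \<otimes> (a \<otimes> b)"
      using ab pow p by (metis Suc_pred' add_Suc_right m_closed nat_pow_Suc nat_pow_closed
          nat_pow_mult r_one)
    then have "(a \<otimes> b) [^] k \<otimes> b = (a \<otimes> b) [^] (k + (p - 1)) \<otimes> a"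
      using ab sq ca by (simp add: m_assoc)
    moreover have "(a \<otimes> b) [^] k \<otimes> a \<otimes> b = (a \<otimes> b) [^] Suc k"
      using ab ca by (simp add: m_assoc)
    ultimately show ?thesis using 2 k by metis
  qed
qed (use ab sq in auto)

text \<open>A rotation killed by \<open>h\<close> has exponent divisible by \<open>p\<close> and is
  already trivial in \<open>G\<close>. A reflection cannot be killed: otherwise \<open>h a\<close>
  would be a power of the rotation in \<open>H\<close>, whose order would then divide two.\<close>

lemma (in group_hom) inj_on_dihedral:
  assumes ab: "a \<in> carrier G" "b \<in> carrier G"
    and sq: "a \<otimes> a = \<one>" "b \<otimes> b = \<one>" and pow: "(a \<otimes> b) [^] (p::nat) = \<one>"
    and ord: "group.ord H (h a \<otimes>\<^bsub>H\<^esub> h b) = p" and p: "p \<ge> 3"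
  shows "inj_on h (generate G {a, b})"
proof -
  have sub: "subgroup (generate G {a, b}) G" using ab by (intro G.generate_is_subgroup) auto
  let ?u = "h a" and ?v = "h b"
  have uv: "?u \<in> carrier H" "?v \<in> carrier H" "?u \<otimes>\<^bsub>H\<^esub> ?u = \<one>\<^bsub>H\<^esub>" "?v \<otimes>\<^bsub>H\<^esub> ?v = \<one>\<^bsub>H\<^esub>"
    using ab sq by (auto simp flip: hom_mult)
  have triv: "x = \<one>" if x: "x \<in> generate G {a, b}" and hx: "h x = \<one>\<^bsub>H\<^esub>" for x
  proof -
    obtain k :: nat where "x = (a \<otimes> b) [^] k \<or> x = (a \<otimes> b) [^] k \<otimes> a"
      using G.generate_two_involutions[OF x ab sq pow] p by auto
    then show ?thesis
    proof
      assume k: "x = (a \<otimes> b) [^] k"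
      then have "(?u \<otimes>\<^bsub>H\<^esub> ?v) [^]\<^bsub>H\<^esub> k = \<one>\<^bsub>H\<^esub>" using hx ab by (simp add: hom_nat_pow)
      then have "p dvd k" using ord uv by (simp add: H.pow_eq_id)
      then show ?thesis using k pow ab by (metis G.nat_pow_one G.nat_pow_pow dvdE G.m_closed)
    next
      assume k: "x = (a \<otimes> b) [^] k \<otimes> a"
      let ?w = "(?u \<otimes>\<^bsub>H\<^esub> ?v)"
      have "?w [^]\<^bsub>H\<^esub> k \<otimes>\<^bsub>H\<^esub> ?u = \<one>\<^bsub>H\<^esub>" using k hx ab by (simp add: hom_nat_pow)
      \<comment> \<open>As a power of \<open>?w\<close>, the element \<open>?u\<close> commutes with
        \<open>?w\<close>; as a reflection it also inverts \<open>?w\<close>. Hence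
        \<open>?w\<close> squares to the identity.\<close>
      then have wk: "?w [^]\<^bsub>H\<^esub> k = ?u" using uv
        by (metis H.inv_equality H.m_closed H.nat_pow_closed H.inv_inv)
      have "?u \<otimes>\<^bsub>H\<^esub> ?w = ?w \<otimes>\<^bsub>H\<^esub> ?u"
        using H.nat_pow_Suc[of ?w k] H.nat_pow_Suc2[of ?w k] uv wk by simp
      then have "?v = ?w \<otimes>\<^bsub>H\<^esub> ?u" using uv by (metis H.l_one H.m_assoc)
      then have "?w \<otimes>\<^bsub>H\<^esub> ?w = \<one>\<^bsub>H\<^esub>" using uv by (metis H.m_assoc H.m_closed)
      then have "?w [^]\<^bsub>H\<^esub> (2::nat) = \<one>\<^bsub>H\<^esub>" using uv by (simp add: numeral_2_eq_2)
      then have "p dvd 2" using ord uv by (simp add: H.pow_eq_id)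
      then show ?thesis using p by (auto dest: dvd_imp_le)
    qed
  qed
  show ?thesis
  proof (rule inj_onI)
    fix x y assume xy: "x \<in> generate G {a, b}" "y \<in> generate G {a, b}" and e: "h x = h y"
    have c: "x \<in> carrier G" "y \<in> carrier G" using xy subgroup.subset[OF sub] by auto
    have "x \<otimes> inv y = \<one>"
      using e c xy sub by (intro triv) (auto simp: subgroup.m_closed subgroup.m_inv_closed)
    then show "x = y" using c by (metis G.inv_equality G.inv_inv G.inv_closed)
  qed
qed

text \<open>If h kills the generator with index k and is faithful on the dihedral subgroup of the other
  two generators, then intersections with a subgroup of that dihedral group can be computed
  after applying h.\<close>

lemma (in group_hom) generate_inter_dihedral:
  assumes cl: "\<rho> ` {i, j, k} \<subseteq> carrier G"
    and sq: "\<And>l. l \<in> {i, j, k} \<Longrightarrow> \<rho> l \<otimes> \<rho> l = \<one>"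
    and pow: "(\<rho> i \<otimes> \<rho> j) [^] (p::nat) = \<one>"
    and ord: "group.ord H (h (\<rho> i) \<otimes>\<^bsub>H\<^esub> h (\<rho> j)) = p" and p: "p \<ge> 3"
    and k: "h (\<rho> k) = \<one>\<^bsub>H\<^esub>"
    and I: "I \<subseteq> {i, j}" and J: "J \<subseteq> {i, j, k}"
  shows "generate G (\<rho> ` I) \<inter> generate G (\<rho> ` J) \<subseteq> generate G (\<rho> ` (I \<inter> J))"
proof
  fix x assume x: "x \<in> generate G (\<rho> ` I) \<inter> generate G (\<rho> ` J)"
  have c: "\<rho> i \<in> carrier G" "\<rho> j \<in> carrier G" and s: "\<rho> i \<otimes> \<rho> i = \<one>" "\<rho> j \<otimes> \<rho> j = \<one>"
    using cl sq by auto
  let ?D = "generate G {\<rho> i, \<rho> j}"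
  have inj: "inj_on h ?D" using inj_on_dihedral[OF c s pow ord p] .
  have one: "\<one> \<in> ?D" by (rule generate.one)
  have ii: "\<rho> i \<in> ?D" and jj: "\<rho> j \<in> ?D" by (auto intro: generate.incl)
  have "\<rho> ` I \<subseteq> {\<rho> i, \<rho> j}" using I by auto
  then have xD: "x \<in> ?D" using x G.mono_generate by blast
  have hsq: "h (\<rho> l) \<otimes>\<^bsub>H\<^esub> h (\<rho> l) = \<one>\<^bsub>H\<^esub>" if "l \<in> {i, j}" for l
    using that c s by (auto simp flip: hom_mult)
  have ne: "h (\<rho> i) \<noteq> h (\<rho> j)"
  proof
    assume "h (\<rho> i) = h (\<rho> j)"
    then have "p = 1" using ord hsq[of i] H.ord_id by simp
    then show False using p by simp
  qed
  \<comment> \<open>If \<open>l\<close> is missing from \<open>L\<close>, then \<open>h\<close>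
    sends every generator indexed by \<open>L\<close> to the identity or to
    \<open>h (\<rho> m)\<close>, which squares to the identity, so the image of that subgroup has at
    most two elements.\<close>
  have miss: "h x \<in> {\<one>\<^bsub>H\<^esub>, h (\<rho> m)}"
    if "{l, m} = {i, j}" "l \<notin> L" "L \<subseteq> {i, j, k}" "x \<in> generate G (\<rho> ` L)" for l m L
    using that(4)
  proof (induction rule: G.generate_involutions_induct)
    case (step y x)
    then obtain a where "a \<in> L" "x = \<rho> a" by auto
    then have "x = \<rho> m \<or> x = \<rho> k" using that by auto
    moreover have "m \<in> {i, j}" using that by auto
    ultimately show ?case using step k hsq[of m] cl by auto
  qed (use that cl sq in \<open>auto simp: image_subset_iff subset_iff\<close>)
  have IJ: "I \<subseteq> {i, j, k}" using I by auto
  \<comment> \<open>An index outside \<open>I \<inter> J\<close> is missing from \<open>I\<close> or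
    from \<open>J\<close>, and \<open>x\<close> lies in both subgroups.\<close>
  have missi: "h x \<in> {\<one>\<^bsub>H\<^esub>, h (\<rho> j)}" if "i \<notin> I \<inter> J"
    using that miss[of i j I] miss[of i j J] x J IJ by auto
  have missj: "h x \<in> {\<one>\<^bsub>H\<^esub>, h (\<rho> i)}" if "j \<notin> I \<inter> J"
    using that miss[of j i I] miss[of j i J] x J IJ by auto
  have eq: "x = y" if "h x = h y" "y \<in> ?D" for y
    using inj xD that by (meson inj_onD)
  show "x \<in> generate G (\<rho> ` (I \<inter> J))"
  proof (cases "i \<in> I \<inter> J"; cases "j \<in> I \<inter> J")
    assume "i \<in> I \<inter> J" "j \<in> I \<inter> J"
    then have "I \<inter> J = I" using I by auto
    then show ?thesis using x by simp
  next
    assume a: "i \<in> I \<inter> J" "j \<notin> I \<inter> J"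
    then have "x = \<one> \<or> x = \<rho> i" using missj eq[of \<one>] eq[of "\<rho> i"] one ii by auto
    then show ?thesis using a by (auto intro: generate.one generate.incl)
  next
    assume a: "i \<notin> I \<inter> J" "j \<in> I \<inter> J"
    then have "x = \<one> \<or> x = \<rho> j" using missi eq[of \<one>] eq[of "\<rho> j"] one jj by auto
    then show ?thesis using a by (auto intro: generate.one generate.incl)
  next
    assume "i \<notin> I \<inter> J" "j \<notin> I \<inter> J"
    then have "h x = \<one>\<^bsub>H\<^esub>" using missi missj ne by auto
    then show ?thesis using eq[of \<one>] one by (auto intro: generate.one)
  qed
qed

section \<open>Central involutions in 2-groups\<close>

text \<open>By the class equation: \<open>K\<close> is a disjoint union of conjugacy classes whose
  sizes are powers of two, so the class of the identity cannot be the only one of size one. Another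
  such class gives a central element, and a power of it has order two.\<close>

lemma (in group) central_involution_in_normal_subgroup:
  assumes ord: "order G = 2 ^ N" and K: "K \<lhd> G" and K1: "K \<noteq> {\<one>}"
  shows "\<exists>z\<in>K. z \<noteq> \<one> \<and> z \<otimes> z = \<one> \<and> (\<forall>g\<in>carrier G. g \<otimes> z = z \<otimes> g)"
proof -
  have fin: "finite (carrier G)" using ord order_gt_0_iff_finite by simp
  have Ks: "subgroup K G" using K by (simp add: normal_imp_subgroup)
  have Kc: "K \<subseteq> carrier G" using Ks by (rule subgroup.subset)
  let ?\<phi> = "\<lambda>g. \<lambda>h \<in> carrier G. g \<otimes> h \<otimes> inv g"
  interpret act: group_action G "carrier G" ?\<phi> by (rule action_by_conjugation)
  define cl where "cl = orbit G ?\<phi>"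
  have orb: "cl x = {g \<otimes> x \<otimes> inv g | g. g \<in> carrier G}" if "x \<in> carrier G" for x
    using that by (auto simp: cl_def orbit_def)
  have refl: "x \<in> cl x" if "x \<in> carrier G" for x
    unfolding cl_def using that by (rule act.orbit_refl)
  have OK: "cl x \<subseteq> K" if "x \<in> K" for x
  proof -
    have "g \<otimes> x \<otimes> inv g \<in> K" if "g \<in> carrier G" for g
      using normal_invE(2)[OF K that \<open>x \<in> K\<close>] .
    then show ?thesis using orb that Kc by (auto simp: subset_iff)
  qed
  have cardK: "card K = (\<Sum>X\<in>cl ` K. card X)"
  proof -
    have "\<Union> (cl ` K) = K" using OK refl Kc by blast
    moreover have "card (\<Union> (cl ` K)) = (\<Sum>X\<in>cl ` K. card X)"
    proof (rule card_Union_disjoint)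
      show "pairwise disjnt (cl ` K)"
        unfolding pairwise_def disjnt_def
      proof (intro ballI impI)
        fix A B assume "A \<in> cl ` K" "B \<in> cl ` K" "A \<noteq> B"
        moreover have "cl ` K \<subseteq> orbits G (carrier G) ?\<phi>" using Kc by (auto simp: cl_def orbits_def)
        ultimately show "A \<inter> B = {}" using act.disjoint_union by blast
      qed
      show "\<And>A. A \<in> cl ` K \<Longrightarrow> finite A" 
        using OK finite_subset[OF Kc fin] by (auto intro: finite_subset)
    qed
    ultimately show ?thesis by simp
  qed
  have one_orb: "cl \<one> = {\<one>}" unfolding orb[OF one_closed] by (auto intro: exI[of _ \<one>])
  have central: "g \<otimes> x = x \<otimes> g" if "cl x = {x}" "x \<in> carrier G" "g \<in> carrier G" for x g
  proof -
    have "g \<otimes> x \<otimes> inv g = x" using that orb[of x] by auto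
    then show ?thesis using that by (metis inv_solve_right' m_closed)
  qed
  have "\<exists>x\<in>K. x \<noteq> \<one> \<and> cl x = {x}"
  proof (rule ccontr)
    \<comment> \<open>Every class but that of the identity then has even size, so
      \<open>card K\<close> is odd; as a divisor of \<open>2 ^ N\<close> it is one.\<close>
    assume neg: "\<not> ?thesis"
    have ev: "even (card X)" if X: "X \<in> cl ` K - {{\<one>}}" for X
    proof -
      obtain x where x: "x \<in> K" "X = cl x" using X by auto
      have x1: "x \<noteq> \<one>" using X x(2) one_orb by blast
      have "card X * card (stabilizer G ?\<phi> x) = order G"
        unfolding x(2) cl_def using x(1) Kc by (intro act.orbit_stabilizer_theorem) auto
      then have "card X dvd 2 ^ N" unfolding ord by (rule dvdI[OF sym])
      then obtain i where i: "card X = 2 ^ i" using divides_primepow_nat[OF two_is_prime_nat] by auto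
      have "x \<in> X" using x refl Kc by auto
      have "i \<noteq> 0"
      proof
        assume "i = 0"
        then have "card X = 1" using i by simp
        then have "X = {x}" using \<open>x \<in> X\<close> by (metis card_1_singletonE singletonD)
        then show False using neg x x1 by blast
      qed
      then show ?thesis using i by simp
    qed
    have "{\<one>} \<in> cl ` K" using one_orb subgroup.one_closed[OF Ks] by (metis imageI)
    moreover have "finite (cl ` K)" using fin Kc finite_subset by blast
    ultimately have "card K = 1 + (\<Sum>X\<in>cl ` K - {{\<one>}}. card X)"
      unfolding cardK by (subst sum.remove[of _ "{\<one>}"]) auto
    moreover have "even (\<Sum>X\<in>cl ` K - {{\<one>}}. card X)" using ev by (intro dvd_sum)
    ultimately have "odd (card K)" by simp
    moreover have "card K dvd 2 ^ N"
      using lagrange[OF Ks] ord by (metis dvd_triv_right)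
    then obtain i where "card K = 2 ^ i" using divides_primepow_nat[OF two_is_prime_nat] by auto
    ultimately have "card K = 1" by (cases i) auto
    then show False using K1 subgroup.one_closed[OF Ks] by (metis card_1_singletonE singletonD)
  qed
  then obtain x where x: "x \<in> K" "x \<noteq> \<one>" "cl x = {x}" by blast
  have xc: "x \<in> carrier G" using x Kc by auto
  have "ord x dvd 2 ^ N" using ord ord_dvd_group_order[OF xc] by simp
  then obtain i where i: "ord x = 2 ^ i" using divides_primepow_nat[OF two_is_prime_nat] by auto
  have "i \<noteq> 0" using i x(2) ord_eq_1[OF xc] by auto
  then obtain j where j: "i = Suc j" by (cases i) auto
  \<comment> \<open>The order of \<open>x\<close> is \<open>2 ^ Suc j\<close>, so this power has
    order two.\<close>
  define z where "z = x [^] (2 ^ j :: nat)"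
  have zc: "z \<in> carrier G" using xc z_def by simp
  have "x [^] (k::nat) \<in> K" for k
    using x(1) Ks by (induction k) (auto simp: subgroup.one_closed subgroup.m_closed)
  then have "z \<in> K" by (simp add: z_def)
  moreover have "z \<noteq> \<one>"
    unfolding z_def using xc i j by (auto simp: pow_eq_id dest: dvd_imp_le)
  moreover have "z \<otimes> z = \<one>"
    unfolding z_def using xc i j pow_ord_eq_1[OF xc] by (simp add: nat_pow_mult mult_2)
  moreover have "g \<otimes> z = z \<otimes> g" if g: "g \<in> carrier G" for g
    unfolding z_def using group_commutes_pow[OF central[OF x(3) xc g, symmetric] xc g]
    by simp
  ultimately show ?thesis by blast
qed

section \<open>Dihedral groups and wreath products with a swap\<close>

text \<open>The pair (a, e) stands for the map sending x to a - x if e holds, and to a + x otherwise,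
  on the integers modulo m.\<close>

definition dihedral :: "nat \<Rightarrow> (int \<times> bool) monoid" where
  "dihedral m = \<lparr>carrier = {0..<int m} \<times> UNIV,
     monoid.mult = (\<lambda>(a, e) (b, f). ((if e then a - b else a + b) mod int m, e \<noteq> f)),
     one = (0, False)\<rparr>"

lemma carrier_dihedral: "carrier (dihedral m) = {0..<int m} \<times> UNIV"
  by (simp add: dihedral_def)

lemma one_dihedral [simp]: "\<one>\<^bsub>dihedral m\<^esub> = (0, False)"
  by (simp add: dihedral_def)

lemma mult_dihedral [simp]:
  "(a, e) \<otimes>\<^bsub>dihedral m\<^esub> (b, f) = ((if e then a - b else a + b) mod int m, e \<noteq> f)"
  by (simp add: dihedral_def)

lemma order_dihedral: "order (dihedral m) = 2 * m"
  by (simp add: order_def carrier_dihedral card_cartesian_product)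

lemma group_dihedral:
  assumes "m > 0"
  shows "group (dihedral m)"
proof (rule groupI)
  fix x assume x: "x \<in> carrier (dihedral m)"
  obtain a e where ae: "x = (a, e)" by fastforce
  show "\<exists>y\<in>carrier (dihedral m). y \<otimes>\<^bsub>dihedral m\<^esub> x = \<one>\<^bsub>dihedral m\<^esub>"
    by (rule bexI[of _ "(if e then a else (- a) mod int m, e)"])
      (use assms x in \<open>auto simp: ae carrier_dihedral mod_simps\<close>)
qed (use assms in \<open>auto simp: carrier_dihedral mod_simps algebra_simps split: if_splits\<close>)

lemma dihedral_rotation_pow:
  "(k mod int m, False) [^]\<^bsub>dihedral m\<^esub> (l::nat) = (k * int l mod int m, False)"
proof (induction l)
  case (Suc l)
  then show ?case by (simp add: mod_simps algebra_simps)
qed simp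

lemma ord_dihedral:
  assumes "m \<ge> 2"
  shows "group.ord (dihedral m) ((0, True) \<otimes>\<^bsub>dihedral m\<^esub> (1, True)) = m"
    and "group.ord (dihedral m) ((1, True) \<otimes>\<^bsub>dihedral m\<^esub> (0, True)) = m"
proof -
  interpret group "dihedral m" using assms by (intro group_dihedral) simp
  \<comment> \<open>The two products of reflections are the rotations by -1 and by 1.\<close>
  have "ord (k mod int m, False) = m" if "k = 1 \<or> k = -1" for k
  proof (subst ord_unique)
    show "(k mod int m, False) \<in> carrier (dihedral m)" using assms by (simp add: carrier_dihedral)
    have "int m dvd k * int l \<longleftrightarrow> m dvd l" for l using that by auto
    then show "\<forall>l. ((k mod int m, False) [^]\<^bsub>dihedral m\<^esub> l = \<one>\<^bsub>dihedral m\<^esub>) = (m dvd l)"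
      by (simp add: dihedral_rotation_pow dvd_eq_mod_eq_0)
  qed
  from this[of "-1"] this[of 1] show "ord ((0, True) \<otimes>\<^bsub>dihedral m\<^esub> (1, True)) = m"
    "ord ((1, True) \<otimes>\<^bsub>dihedral m\<^esub> (0, True)) = m"
    by simp_all
qed

text \<open>The flag acts on the factor to its right by exchanging coordinates. For dihedral
  \<open>D\<close> this group acts on a square grid on the torus, each copy of \<open>D\<close>
  along one axis, with the flag swapping the axes.\<close>

definition swap_wreath :: "('a, 'b) monoid_scheme \<Rightarrow> (('a \<times> 'a) \<times> bool) monoid" where
  "swap_wreath D = \<lparr>carrier = (carrier D \<times> carrier D) \<times> UNIV,
     monoid.mult = (\<lambda>((a, b), e) ((c, d), f).
       (if e then (a \<otimes>\<^bsub>D\<^esub> d, b \<otimes>\<^bsub>D\<^esub> c) else (a \<otimes>\<^bsub>D\<^esub> c, b \<otimes>\<^bsub>D\<^esub> d), e \<noteq> f)),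
     one = ((\<one>\<^bsub>D\<^esub>, \<one>\<^bsub>D\<^esub>), False)\<rparr>"

lemma carrier_swap_wreath: "carrier (swap_wreath D) = (carrier D \<times> carrier D) \<times> UNIV"
  by (simp add: swap_wreath_def)

lemma one_swap_wreath [simp]: "\<one>\<^bsub>swap_wreath D\<^esub> = ((\<one>\<^bsub>D\<^esub>, \<one>\<^bsub>D\<^esub>), False)"
  by (simp add: swap_wreath_def)

lemma mult_swap_wreath [simp]:
  "((a, b), e) \<otimes>\<^bsub>swap_wreath D\<^esub> ((c, d), f) =
     (if e then (a \<otimes>\<^bsub>D\<^esub> d, b \<otimes>\<^bsub>D\<^esub> c) else (a \<otimes>\<^bsub>D\<^esub> c, b \<otimes>\<^bsub>D\<^esub> d), e \<noteq> f)"
  by (simp add: swap_wreath_def)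

lemma order_swap_wreath: "order (swap_wreath D) = 2 * order D ^ 2"
  by (simp add: order_def carrier_swap_wreath card_cartesian_product power2_eq_square)

lemma group_swap_wreath:
  assumes "group D"
  shows "group (swap_wreath D)"
proof (rule groupI)
  interpret group D by fact
  fix x assume x: "x \<in> carrier (swap_wreath D)"
  obtain a b e where abe: "x = ((a, b), e)" by (metis surj_pair)
  show "\<exists>y\<in>carrier (swap_wreath D). y \<otimes>\<^bsub>swap_wreath D\<^esub> x = \<one>\<^bsub>swap_wreath D\<^esub>"
    by (rule bexI[of _ "(if e then (inv\<^bsub>D\<^esub> b, inv\<^bsub>D\<^esub> a) else (inv\<^bsub>D\<^esub> a, inv\<^bsub>D\<^esub> b), e)"])
      (use x in \<open>auto simp: abe carrier_swap_wreath\<close>)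
next
  interpret group D by fact
  show "\<And>x y z. \<lbrakk>x \<in> carrier (swap_wreath D); y \<in> carrier (swap_wreath D);
      z \<in> carrier (swap_wreath D)\<rbrakk> \<Longrightarrow>
    x \<otimes>\<^bsub>swap_wreath D\<^esub> y \<otimes>\<^bsub>swap_wreath D\<^esub> z =
    x \<otimes>\<^bsub>swap_wreath D\<^esub> (y \<otimes>\<^bsub>swap_wreath D\<^esub> z)"
    by (auto simp: carrier_swap_wreath m_assoc)
qed (use assms in \<open>auto simp: carrier_swap_wreath group.is_monoid monoid.m_closed monoid.one_closed
      monoid.l_one split: if_splits\<close>)

section \<open>Groups covering two dihedral groups\<close>

text \<open>The conditions survive quotients by normal subgroups on which both maps are trivial. The
  power relations bound the orders of the rotations from above, and the maps \<open>f\<close> and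
  \<open>g\<close> bound them from below.\<close>

locale dihedral_cover = group G for G (structure) +
  fixes \<rho> :: "nat \<Rightarrow> 'a" and p q :: nat and f g :: "'a \<Rightarrow> int \<times> bool"
  assumes gens_closed: "\<rho> ` {0, 1, 2} \<subseteq> carrier G"
    and gens_square: "i \<in> {0, 1, 2} \<Longrightarrow> \<rho> i \<otimes> \<rho> i = \<one>"
    and gens_generate: "generate G (\<rho> ` {0, 1, 2}) = carrier G"
    and gens_commute: "\<rho> 0 \<otimes> \<rho> 2 = \<rho> 2 \<otimes> \<rho> 0"
    and pow_p: "(\<rho> 0 \<otimes> \<rho> 1) [^] p = \<one>"
    and pow_q: "(\<rho> 1 \<otimes> \<rho> 2) [^] q = \<one>"
    and hom_f: "f \<in> hom G (dihedral p)"
    and hom_g: "g \<in> hom G (dihedral q)"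
    and f_gens: "f (\<rho> 0) = (0, True)" "f (\<rho> 1) = (1, True)" "f (\<rho> 2) = (0, False)"
    and g_gens: "g (\<rho> 0) = (0, False)" "g (\<rho> 1) = (1, True)" "g (\<rho> 2) = (0, True)"
    \<comment> \<open>For even p and q both sides are the parity of the number of factors \<rho> 1 in x.\<close>
    and parity: "x \<in> carrier G \<Longrightarrow> even (fst (f x)) = even (fst (g x))"

text \<open>If both index sets contain 0 and 2, one includes the other. Otherwise one of them lies
  in {0, 1} or in {1, 2}, where \<open>f\<close> or \<open>g\<close> is faithful and the dihedral
  intersection lemma applies.\<close>

lemma (in dihedral_cover) string_C_group:
  assumes p: "p \<ge> 3" and q: "q \<ge> 3"
  shows "string_C_group_rank3 G \<rho>" and "schlafli_type G \<rho> = (p, q)"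
proof -
  interpret f: group_hom G "dihedral p" f
    using hom_f p by (auto simp: group_hom_def group_hom_axioms_def intro: group_dihedral)
  interpret g: group_hom G "dihedral q" g
    using hom_g q by (auto simp: group_hom_def group_hom_axioms_def intro: group_dihedral)
  have c: "\<rho> 0 \<in> carrier G" "\<rho> 1 \<in> carrier G" "\<rho> 2 \<in> carrier G" using gens_closed by auto
  have of: "group.ord (dihedral p) (f (\<rho> 0) \<otimes>\<^bsub>dihedral p\<^esub> f (\<rho> 1)) = p"
    unfolding f_gens using p by (intro ord_dihedral) simp
  have og: "group.ord (dihedral q) (g (\<rho> 1) \<otimes>\<^bsub>dihedral q\<^esub> g (\<rho> 2)) = q"
    unfolding g_gens using q by (intro ord_dihedral) simp
  have fk: "f (\<rho> 2) = \<one>\<^bsub>dihedral p\<^esub>" and gk: "g (\<rho> 0) = \<one>\<^bsub>dihedral q\<^esub>"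
    using f_gens g_gens by auto
  have sub01: "generate G (\<rho> ` I) \<inter> generate G (\<rho> ` J) \<subseteq> generate G (\<rho> ` (I \<inter> J))"
    if "I \<subseteq> {0, 1}" "J \<subseteq> {0, 1, 2}" for I J
    using f.generate_inter_dihedral[OF gens_closed gens_square pow_p of p fk that] .
  have rot: "{1, 2, 0} = {0, 1, 2 :: nat}" by auto
  have sub12: "generate G (\<rho> ` I) \<inter> generate G (\<rho> ` J) \<subseteq> generate G (\<rho> ` (I \<inter> J))"
    if "I \<subseteq> {1, 2}" "J \<subseteq> {0, 1, 2}" for I J
    using g.generate_inter_dihedral[of \<rho> 1 2 0, unfolded rot,
        OF gens_closed gens_square pow_q og q gk that] .
  have sub: "generate G (\<rho> ` I) \<inter> generate G (\<rho> ` J) \<subseteq> generate G (\<rho> ` (I \<inter> J))"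
    if I: "I \<subseteq> {0, 1, 2}" and J: "J \<subseteq> {0, 1, 2}" for I J
  proof -
    consider "2 \<notin> I" | "0 \<notin> I" | "2 \<notin> J" | "0 \<notin> J" | "0 \<in> I" "2 \<in> I" "0 \<in> J" "2 \<in> J"
      by blast
    then show ?thesis
    proof cases
      case 1
      then have "I \<subseteq> {0, 1}" using I by auto
      then show ?thesis using sub01 J by simp
    next
      case 2
      then have "I \<subseteq> {1, 2}" using I by auto
      then show ?thesis using sub12 J by simp
    next
      case 3
      then have "J \<subseteq> {0, 1}" using J by auto
      then show ?thesis using sub01[of J I] I by (simp add: Int_commute)
    next
      case 4
      then have "J \<subseteq> {1, 2}" using J by auto
      then show ?thesis using sub12[of J I] I by (simp add: Int_commute)
    next
      case 5
      then have "I \<subseteq> J \<or> J \<subseteq> I" using I J by (cases "1 \<in> I") auto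
      then show ?thesis by (auto simp: Int_absorb1 Int_absorb2)
    qed
  qed
  show "string_C_group_rank3 G \<rho>"
  proof unfold_locales
    show "\<rho> ` {0, 1, 2} \<subseteq> carrier G" by (rule gens_closed)
    show "generate G (\<rho> ` {0, 1, 2}) = carrier G" by (rule gens_generate)
    show "\<rho> 0 \<otimes> \<rho> 2 = \<rho> 2 \<otimes> \<rho> 0" by (rule gens_commute)
    fix i :: nat assume i: "i \<in> {0, 1, 2}"
    have ci: "\<rho> i \<in> carrier G" using i c by auto
    have "\<rho> i \<noteq> \<one>" using i f_gens g_gens f.hom_one g.hom_one by auto
    then have "ord (\<rho> i) \<noteq> 1" using ord_eq_1[OF ci] by simp
    moreover have "\<rho> i [^] (2::nat) = \<one>" using ci gens_square[OF i] by (simp add: numeral_2_eq_2)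
    then have "ord (\<rho> i) dvd 2" using ci by (simp add: pow_eq_id)
    ultimately show "ord (\<rho> i) = 2" by (metis prime_nat_iff two_is_prime_nat)
  next
    fix I J :: "nat set" assume I: "I \<subseteq> {0, 1, 2}" and J: "J \<subseteq> {0, 1, 2}"
    have "generate G (\<rho> ` (I \<inter> J)) \<subseteq> generate G (\<rho> ` I) \<inter> generate G (\<rho> ` J)"
      by (intro Int_greatest mono_generate) auto
    then show "generate G (\<rho> ` I) \<inter> generate G (\<rho> ` J) = generate G (\<rho> ` (I \<inter> J))"
      using sub[OF I J] by blast
  qed
  have "ord (\<rho> 0 \<otimes> \<rho> 1) = p"
  proof (rule dvd_antisym)
    show "ord (\<rho> 0 \<otimes> \<rho> 1) dvd p" using pow_p c by (simp add: pow_eq_id)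
    have "f (\<rho> 0 \<otimes> \<rho> 1) [^]\<^bsub>dihedral p\<^esub> ord (\<rho> 0 \<otimes> \<rho> 1) = \<one>\<^bsub>dihedral p\<^esub>"
      using c pow_ord_eq_1[of "\<rho> 0 \<otimes> \<rho> 1"] f.hom_nat_pow[of "\<rho> 0 \<otimes> \<rho> 1" "ord (\<rho> 0 \<otimes> \<rho> 1)"]
        f.hom_one by (simp del: one_dihedral)
    then show "p dvd ord (\<rho> 0 \<otimes> \<rho> 1)" using of c f.H.pow_eq_id[of "f (\<rho> 0 \<otimes> \<rho> 1)"]
      by (simp del: one_dihedral)
  qed
  moreover have "ord (\<rho> 1 \<otimes> \<rho> 2) = q"
  proof (rule dvd_antisym)
    show "ord (\<rho> 1 \<otimes> \<rho> 2) dvd q" using pow_q c by (simp add: pow_eq_id)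
    have "g (\<rho> 1 \<otimes> \<rho> 2) [^]\<^bsub>dihedral q\<^esub> ord (\<rho> 1 \<otimes> \<rho> 2) = \<one>\<^bsub>dihedral q\<^esub>"
      using c pow_ord_eq_1[of "\<rho> 1 \<otimes> \<rho> 2"] g.hom_nat_pow[of "\<rho> 1 \<otimes> \<rho> 2" "ord (\<rho> 1 \<otimes> \<rho> 2)"]
        g.hom_one by (simp del: one_dihedral)
    then show "q dvd ord (\<rho> 1 \<otimes> \<rho> 2)" using og c g.H.pow_eq_id[of "g (\<rho> 1 \<otimes> \<rho> 2)"]
      by (simp del: one_dihedral)
  qed
  ultimately show "schlafli_type G \<rho> = (p, q)" by (simp add: schlafli_type_def)
qed

text \<open>With trivial common kernel, \<open>x\<close> is determined by \<open>f x\<close> and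
  \<open>g x\<close>. The parity of the rotation part of \<open>g x\<close> can be read off from
  \<open>f x\<close>, which saves a factor of two against the product of the two dihedral
  groups.\<close>

lemma (in dihedral_cover) order_le_if_kernel_trivial:
  assumes p: "p > 0" and q: "q > 0" "even q"
    and triv: "kernel G (dihedral p) f \<inter> kernel G (dihedral q) g = {\<one>}"
  shows "order G \<le> 2 * p * q"
proof -
  interpret f: group_hom G "dihedral p" f
    using hom_f p by (auto simp: group_hom_def group_hom_axioms_def intro: group_dihedral)
  interpret g: group_hom G "dihedral q" g
    using hom_g q by (auto simp: group_hom_def group_hom_axioms_def intro: group_dihedral)
  have inj: "x = y" if c: "x \<in> carrier G" "y \<in> carrier G" and e: "f x = f y" "g x = g y" for x y
  proof -
    have "x \<otimes> inv y \<in> kernel G (dihedral p) f \<inter> kernel G (dihedral q) g"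
      using c e by (auto simp: kernel_def simp del: one_dihedral)
    then show ?thesis using triv c by (metis singletonD inv_equality inv_inv inv_closed)
  qed
  let ?h = "\<lambda>x. (f x, fst (g x) div 2, snd (g x))"
  let ?T = "({0..<int p} \<times> (UNIV :: bool set)) \<times> {0..<int (q div 2)} \<times> (UNIV :: bool set)"
  have "inj_on ?h (carrier G)"
  proof (rule inj_onI)
    fix x y assume c: "x \<in> carrier G" "y \<in> carrier G" and e: "?h x = ?h y"
    have "even (fst (g x)) = even (fst (g y))" using e parity[OF c(1)] parity[OF c(2)] by simp
    moreover have "fst (g x) div 2 = fst (g y) div 2" using e by simp
    ultimately have "fst (g x) = fst (g y)" by (metis even_two_times_div_two odd_two_times_div_two_succ)
    then show "x = y" using e c inj by (simp add: prod_eq_iff)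
  qed
  moreover have "?h ` carrier G \<subseteq> ?T"
  proof
    fix z assume "z \<in> ?h ` carrier G"
    then obtain x where x: "x \<in> carrier G" "z = ?h x" by auto
    have "f x \<in> {0..<int p} \<times> UNIV" "g x \<in> {0..<int q} \<times> UNIV"
      using f.hom_closed[OF x(1)] g.hom_closed[OF x(1)] by (auto simp: carrier_dihedral)
    then show "z \<in> ?T" using q x(2) by (auto simp: mem_Times_iff elim!: evenE)
  qed
  ultimately have "order G \<le> card ?T"
    unfolding order_def by (intro card_inj_on_le) auto
  also have "card ?T = 2 * p * q" using q by (simp add: card_cartesian_product)
  finally show ?thesis .
qed

text \<open>Cosets are renamed by natural numbers so that repeated quotients keep one carrier type;
  \<open>f\<close> and \<open>g\<close> factor through because they are trivial on
  \<open>N\<close>.\<close>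

lemma (in dihedral_cover) quotient:
  assumes p: "p > 0" and q: "q > 0" and fin: "finite (carrier G)" and N: "N \<lhd> G"
    and ker: "N \<subseteq> kernel G (dihedral p) f \<inter> kernel G (dihedral q) g"
  shows "\<exists>(G' :: nat monoid) \<rho>' f' g'. dihedral_cover G' \<rho>' p q f' g' \<and>
           order G' * card N = order G"
proof -
  interpret f: group_hom G "dihedral p" f
    using hom_f p by (auto simp: group_hom_def group_hom_axioms_def intro: group_dihedral)
  interpret g: group_hom G "dihedral q" g
    using hom_g q by (auto simp: group_hom_def group_hom_axioms_def intro: group_dihedral)
  have Ns: "subgroup N G" using N by (simp add: normal_imp_subgroup)
  have "finite (rcosets N)" using fin by (simp add: RCOSETS_def)
  then obtain e :: "'a set \<Rightarrow> nat" where e: "inj_on e (rcosets N)"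
    using finite_imp_inj_to_nat_seg by blast
  define \<phi> where "\<phi> x = e (N #> x)" for x
  have rc: "N #> x = N #> y \<longleftrightarrow> x \<otimes> inv y \<in> N" if "x \<in> carrier G" "y \<in> carrier G" for x y
  proof
    assume "N #> x = N #> y"
    then have "x \<in> N #> y" using rcos_self[OF that(1) Ns] by simp
    then show "x \<otimes> inv y \<in> N" using that Ns
      by (auto simp: r_coset_def m_assoc subgroup.mem_carrier)
  next
    assume "x \<otimes> inv y \<in> N"
    moreover have "x = x \<otimes> inv y \<otimes> y" using that by (simp add: m_assoc)
    ultimately have "x \<in> N #> y" by (auto simp: r_coset_def)
    then show "N #> x = N #> y" using repr_independence[of x N y] that Ns by simp
  qed
  have \<phi>_eq: "\<phi> x = \<phi> y \<longleftrightarrow> x \<otimes> inv y \<in> N" if "x \<in> carrier G" "y \<in> carrier G" for x y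
    using that rc[OF that] e rcosetsI[OF subgroup.subset[OF Ns]]
    by (auto simp: \<phi>_def dest: inj_onD)
  \<comment> \<open>The fibres of \<open>\<phi>\<close> are the cosets of \<open>N\<close>, so the
    structure transported along \<open>\<phi>\<close> is the quotient group.\<close>
  have wm: "weak_group_morphism \<phi> N G" using N \<phi>_eq by (rule weak_group_morphismsI)
  define G' where "G' = image_group \<phi> G"
  have G': "group G'" unfolding G'_def using wm by (rule image_group_is_group)
  have h: "\<phi> \<in> hom G G'" unfolding G'_def using wm by (rule weak_group_morphism_is_hom)
  have car: "carrier G' = \<phi> ` carrier G" unfolding G'_def by (rule image_group_carrier)
  interpret h: group_hom G G' \<phi> using h G' by (simp add: group_hom_def group_hom_axioms_def is_group)
  \<comment> \<open>Precomposing \<open>f\<close> and \<open>g\<close> with this choice of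
    representatives gives the induced maps; \<open>rN\<close> shows that the choice does not affect
    them.\<close>
  define r where "r = inv_into (carrier G) \<phi>"
  have r: "r y \<in> carrier G" "\<phi> (r y) = y" if "y \<in> carrier G'" for y
    using that unfolding r_def car by (auto intro: inv_into_into f_inv_into_f)
  have rN: "f (r (\<phi> x)) = f x" "g (r (\<phi> x)) = g x" if x: "x \<in> carrier G" for x
  proof -
    have c: "r (\<phi> x) \<in> carrier G" "\<phi> (r (\<phi> x)) = \<phi> x" using r[of "\<phi> x"] x car by auto
    then have "r (\<phi> x) \<otimes> inv x \<in> N" using \<phi>_eq x by simp
    then have k: "f (r (\<phi> x) \<otimes> inv x) = \<one>\<^bsub>dihedral p\<^esub>" "g (r (\<phi> x) \<otimes> inv x) = \<one>\<^bsub>dihedral q\<^esub>"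
      using ker by (auto simp: kernel_def)
    have eq: "r (\<phi> x) = r (\<phi> x) \<otimes> inv x \<otimes> x" using c x by (simp add: m_assoc)
    show "f (r (\<phi> x)) = f x" using k(1) c x by (subst eq) (simp del: one_dihedral f.hom_inv)
    show "g (r (\<phi> x)) = g x" using k(2) c x by (subst eq) (simp del: one_dihedral g.hom_inv)
  qed
  have cg: "\<rho> 0 \<in> carrier G" "\<rho> 1 \<in> carrier G" "\<rho> 2 \<in> carrier G" using gens_closed by auto
  have "dihedral_cover G' (\<phi> \<circ> \<rho>) p q (f \<circ> r) (g \<circ> r)"
  proof (intro dihedral_cover.intro dihedral_cover_axioms.intro)
    show "group G'" by (rule G')
    show "(\<phi> \<circ> \<rho>) ` {0, 1, 2} \<subseteq> carrier G'" using cg by auto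
    show "(\<phi> \<circ> \<rho>) i \<otimes>\<^bsub>G'\<^esub> (\<phi> \<circ> \<rho>) i = \<one>\<^bsub>G'\<^esub>" if "i \<in> {0, 1, 2}" for i
      using that cg gens_square[OF that] by (auto simp flip: h.hom_mult)
    show "generate G' ((\<phi> \<circ> \<rho>) ` {0, 1, 2}) = carrier G'"
      using h.generate_img[OF gens_closed] gens_generate car by (simp add: image_comp)
    show "(\<phi> \<circ> \<rho>) 0 \<otimes>\<^bsub>G'\<^esub> (\<phi> \<circ> \<rho>) 2 = (\<phi> \<circ> \<rho>) 2 \<otimes>\<^bsub>G'\<^esub> (\<phi> \<circ> \<rho>) 0"
      using cg gens_commute by (simp flip: h.hom_mult)
    show "((\<phi> \<circ> \<rho>) 0 \<otimes>\<^bsub>G'\<^esub> (\<phi> \<circ> \<rho>) 1) [^]\<^bsub>G'\<^esub> p = \<one>\<^bsub>G'\<^esub>"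
      using cg pow_p h.hom_nat_pow[of "\<rho> 0 \<otimes> \<rho> 1" p] by simp
    show "((\<phi> \<circ> \<rho>) 1 \<otimes>\<^bsub>G'\<^esub> (\<phi> \<circ> \<rho>) 2) [^]\<^bsub>G'\<^esub> q = \<one>\<^bsub>G'\<^esub>"
      using cg pow_q h.hom_nat_pow[of "\<rho> 1 \<otimes> \<rho> 2" q] by simp
    show "f \<circ> r \<in> hom G' (dihedral p)"
    proof (rule homI)
      fix x y assume xy: "x \<in> carrier G'" "y \<in> carrier G'"
      then obtain a b where "a \<in> carrier G" "b \<in> carrier G" "x = \<phi> a" "y = \<phi> b" using car by auto
      then show "(f \<circ> r) (x \<otimes>\<^bsub>G'\<^esub> y) = (f \<circ> r) x \<otimes>\<^bsub>dihedral p\<^esub> (f \<circ> r) y"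
        using rN by (simp flip: h.hom_mult)
    qed (use r in auto)
    show "g \<circ> r \<in> hom G' (dihedral q)"
    proof (rule homI)
      fix x y assume xy: "x \<in> carrier G'" "y \<in> carrier G'"
      then obtain a b where "a \<in> carrier G" "b \<in> carrier G" "x = \<phi> a" "y = \<phi> b" using car by auto
      then show "(g \<circ> r) (x \<otimes>\<^bsub>G'\<^esub> y) = (g \<circ> r) x \<otimes>\<^bsub>dihedral q\<^esub> (g \<circ> r) y"
        using rN by (simp flip: h.hom_mult)
    qed (use r in auto)
  qed (use cg rN f_gens g_gens parity r in auto)
  moreover have "order G' * card N = order G"
  proof -
    have "carrier G' = e ` (rcosets N)" by (auto simp: car \<phi>_def RCOSETS_def)
    then have "order G' = card (rcosets N)" using e by (simp add: order_def card_image)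
    then show ?thesis using lagrange[OF Ns] by simp
  qed
  ultimately show ?thesis by blast
qed

lemma (in dihedral_cover) descend:
  assumes ord: "order G = 2 ^ Suc N" and big: "2 * p * q < 2 ^ Suc N"
    and p: "p > 0" and q: "q > 0" "even q"
  shows "\<exists>(G' :: nat monoid) \<rho>' f' g'. dihedral_cover G' \<rho>' p q f' g' \<and> order G' = 2 ^ N"
proof -
  interpret f: group_hom G "dihedral p" f
    using hom_f p by (auto simp: group_hom_def group_hom_axioms_def intro: group_dihedral)
  interpret g: group_hom G "dihedral q" g
    using hom_g q by (auto simp: group_hom_def group_hom_axioms_def intro: group_dihedral)
  let ?K = "kernel G (dihedral p) f \<inter> kernel G (dihedral q) g"
  have "?K \<lhd> G" by (rule normal_subgroup_intersect[OF f.normal_kernel g.normal_kernel])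
  moreover have "?K \<noteq> {\<one>}" using order_le_if_kernel_trivial[OF p q] ord big by linarith
  ultimately obtain z where z: "z \<in> ?K" "z \<noteq> \<one>" "z \<otimes> z = \<one>"
    and central: "\<And>x. x \<in> carrier G \<Longrightarrow> x \<otimes> z = z \<otimes> x"
    using central_involution_in_normal_subgroup[OF ord] by blast
  have zc: "z \<in> carrier G" using z by (simp add: kernel_def)
  have iz: "inv z = z" using z zc by (simp add: inv_equality)
  have Z: "{\<one>, z} \<lhd> G"
  proof (rule normal_invI)
    show "subgroup {\<one>, z} G" using z zc iz by unfold_locales auto
    fix x h assume "x \<in> carrier G" "h \<in> {\<one>, z}"
    then show "x \<otimes> h \<otimes> inv x \<in> {\<one>, z}" using central zc by (auto simp: m_assoc)
  qed
  have "{\<one>, z} \<subseteq> ?K" using z by (auto simp: kernel_def simp del: one_dihedral)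
  then obtain G' :: "nat monoid" and \<rho>' f' g' where
    "dihedral_cover G' \<rho>' p q f' g'" "order G' * card {\<one>, z} = order G"
    using quotient[OF p q(1) _ Z] ord order_gt_0_iff_finite by fastforce
  moreover have "card {\<one>, z} = 2" using z by simp
  ultimately show ?thesis using ord by (metis mult_right_cancel power_Suc2 zero_neq_numeral)
qed

section \<open>Arbitrarily large covers inside a direct product\<close>

lemma nat_pow_DirProd:
  "(a, b) [^]\<^bsub>G \<times>\<times> H\<^esub> (k::nat) = (a [^]\<^bsub>G\<^esub> k, b [^]\<^bsub>H\<^esub> k)"
  by (induction k) auto

lemma (in group) pow_eq_one_dvd:
  assumes "x \<in> carrier G" "x [^] (m::nat) = \<one>" "m dvd n"
  shows "x [^] n = \<one>"
  using assms by (meson dvd_trans pow_eq_id)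

lemma nat_pow_swap_wreath:
  "((a, b), False) [^]\<^bsub>swap_wreath D\<^esub> (k::nat) = ((a [^]\<^bsub>D\<^esub> k, b [^]\<^bsub>D\<^esub> k), False)"
  by (induction k) auto

text \<open>The square is \<open>((a, a), False)\<close>, which squares to the identity. This keeps
  both rotations of order dividing 4 in the wreath factor.\<close>

lemma pow_four_swap_wreath:
  assumes "group D" "a \<in> carrier D" "a \<otimes>\<^bsub>D\<^esub> a = \<one>\<^bsub>D\<^esub>"
  shows "((a, \<one>\<^bsub>D\<^esub>), True) [^]\<^bsub>swap_wreath D\<^esub> (4::nat) = \<one>\<^bsub>swap_wreath D\<^esub>"
proof -
  interpret group D by fact
  show ?thesis using assms by (simp add: eval_nat_numeral)
qed

text \<open>In the third factor, the wreath product, the generators generate the group of a toroidal map of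
  type {4, 4}. It does not affect the orders of the two rotations, but makes the group as large as
  desired, since the product of \<rho> 0 and the conjugate of \<rho> 2 by \<rho> 1 has order c there.\<close>

lemma large_dihedral_cover:
  assumes s: "s \<ge> 2" and t: "t \<ge> 2" and n: "n \<ge> 1"
  shows "\<exists>N\<ge>n. \<exists>(G :: nat monoid) \<rho> f g.
           dihedral_cover G \<rho> (2 ^ s) (2 ^ t) f g \<and> order G = 2 ^ N"
proof -
  define p q c :: nat where "p = 2 ^ s" and "q = 2 ^ t" and "c = 2 ^ n"
  have p: "4 dvd p" "p > 0" "p \<ge> 2" "even p" and q: "4 dvd q" "q > 0" "q \<ge> 2" "even q"
    using s t le_imp_power_dvd[of 2 s "2::nat"] le_imp_power_dvd[of 2 t "2::nat"]
    by (auto simp: p_def q_def intro: self_le_power order_trans[OF _ power_increasing[of 1]])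
  have c: "c > 0" "c \<ge> 2" using n power_increasing[of 1 n "2::nat"] by (auto simp: c_def)
  let ?W = "swap_wreath (dihedral c)"
  define A where "A = dihedral p \<times>\<times> (dihedral q \<times>\<times> ?W)"
  interpret P: group "dihedral p" using p by (intro group_dihedral)
  interpret Q: group "dihedral q" using q by (intro group_dihedral)
  interpret C: group "dihedral c" using c by (intro group_dihedral)
  interpret W: group ?W by (intro group_swap_wreath C.is_group)
  interpret A: group A unfolding A_def by (intro DirProd_group P.is_group Q.is_group W.is_group)
  \<comment> \<open>The first two coordinates are the prescribed values of \<open>f\<close> and
    \<open>g\<close>. In the third, \<open>\<rho> 0\<close> and \<open>\<rho> 2\<close> reflect
    different axes, hence commute, and \<open>\<rho> 1\<close> swaps the axes. Index 2 gets the
    default value of the function.\<close>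
  define \<rho> :: "nat \<Rightarrow> (int \<times> bool) \<times> (int \<times> bool) \<times> ((int \<times> bool) \<times> (int \<times> bool)) \<times> bool" where
    "\<rho> = (\<lambda>_. ((0, False), (0, True), (((0, False), (1, True)), False)))
       (0 := ((0, True), (0, False), (((0, True), (0, False)), False)),
        1 := ((1, True), (1, True), (((0, False), (0, False)), True)))"
  have \<rho>: "\<rho> 0 = ((0, True), (0, False), (((0, True), (0, False)), False))"
    "\<rho> 1 = ((1, True), (1, True), (((0, False), (0, False)), True))"
    "\<rho> 2 = ((0, False), (0, True), (((0, False), (1, True)), False))"
    by (simp_all add: \<rho>_def)
  note \<rho>' = \<rho> \<rho>(2)[unfolded One_nat_def]
  define X where "X = \<rho> ` {0, 1, 2}"
  have XA: "X \<subseteq> carrier A"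
    using p q c by (auto simp: X_def \<rho>' A_def carrier_dihedral carrier_swap_wreath)
  have sq: "x \<otimes>\<^bsub>A\<^esub> x = \<one>\<^bsub>A\<^esub>" if "x \<in> X" for x
    using that by (auto simp: X_def \<rho>' A_def)
  define G where "G = A\<lparr>carrier := generate A X\<rparr>"
  have sub: "subgroup (generate A X) A" using XA by (rule A.generate_is_subgroup)
  have G: "group G" unfolding G_def by (rule A.subgroup_imp_group[OF sub])
  interpret G: group G by (rule G)
  have carG: "carrier G = generate A X" and multG: "x \<otimes>\<^bsub>G\<^esub> y = x \<otimes>\<^bsub>A\<^esub> y"
    and oneG: "\<one>\<^bsub>G\<^esub> = \<one>\<^bsub>A\<^esub>" for x y by (simp_all add: G_def)
  have powG: "x [^]\<^bsub>G\<^esub> k = x [^]\<^bsub>A\<^esub> k" for x and k :: nat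
    unfolding G_def by (rule A.nat_pow_consistent[symmetric])
  have GA: "carrier G \<subseteq> carrier A" using subgroup.subset[OF sub] carG by simp
  have finA: "finite (carrier A)" by (simp add: A_def carrier_dihedral carrier_swap_wreath)
  have finG: "finite (carrier G)" using finite_subset[OF GA finA] .
  \<comment> \<open>Only \<open>\<rho> 1\<close> has odd rotation parts, in both dihedral factors at
    once, and reduction modulo the even numbers \<open>p\<close> and \<open>q\<close> keeps
    parity.\<close>
  have par: "even (fst (fst x)) = even (fst (fst (snd x)))" if "x \<in> carrier G" for x
    using that unfolding carG
  proof (induction rule: A.generate_involutions_induct)
    case (step y x)
    obtain a e b d w where "y = ((a, e), (b, d), w)" by (metis surj_pair)
    then show ?case using step p q
      by (auto simp: X_def \<rho>' A_def dvd_mod_iff mult_DirProd' split: if_splits)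
  qed (use XA sq in \<open>auto simp: A_def\<close>)
  have ordp: "((0, True) \<otimes>\<^bsub>dihedral p\<^esub> (1, True)) [^]\<^bsub>dihedral p\<^esub> p = \<one>\<^bsub>dihedral p\<^esub>"
    using dihedral_rotation_pow[where k = "-1" and m = p and l = p] by simp
  have ordq: "((1, True) \<otimes>\<^bsub>dihedral q\<^esub> (0, True)) [^]\<^bsub>dihedral q\<^esub> q = \<one>\<^bsub>dihedral q\<^esub>"
    using dihedral_rotation_pow[where k = 1 and m = q and l = q] by simp
  \<comment> \<open>In \<open>dihedral q\<close> the product of \<open>\<rho> 0\<close> and
    \<open>\<rho> 1\<close> is the reflection \<open>(1, True)\<close>, which the even exponent
    \<open>p\<close> kills; \<open>refl_p\<close> is the counterpart for \<open>\<rho> 1\<close> and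
    \<open>\<rho> 2\<close>.\<close>
  have refl_q: "(1, True) [^]\<^bsub>dihedral q\<^esub> p = \<one>\<^bsub>dihedral q\<^esub>"
    by (rule Q.pow_eq_one_dvd[of _ 2]) (use p q in \<open>auto simp: carrier_dihedral eval_nat_numeral\<close>)
  have refl_p: "(1, True) [^]\<^bsub>dihedral p\<^esub> q = \<one>\<^bsub>dihedral p\<^esub>"
    by (rule P.pow_eq_one_dvd[of _ 2]) (use p q in \<open>auto simp: carrier_dihedral eval_nat_numeral\<close>)
  \<comment> \<open>The two values of \<open>a\<close> belong to the products of
    \<open>\<rho> 0\<close>, \<open>\<rho> 1\<close> and of \<open>\<rho> 1\<close>,
    \<open>\<rho> 2\<close>.\<close>
  have w: "((a, (0, False)), True) [^]\<^bsub>?W\<^esub> k = \<one>\<^bsub>?W\<^esub>"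
    if "a = (0, True) \<or> a = (1, True)" "4 dvd k" for a and k :: nat
  proof (rule W.pow_eq_one_dvd[OF _ _ that(2)])
    show "((a, (0, False)), True) \<in> carrier ?W"
      using that c by (auto simp: carrier_swap_wreath carrier_dihedral)
    show "((a, (0, False)), True) [^]\<^bsub>?W\<^esub> (4::nat) = \<one>\<^bsub>?W\<^esub>"
      using pow_four_swap_wreath[OF C.is_group, of a] that c by (auto simp: carrier_dihedral)
  qed
  have \<rho>c: "\<rho> i \<in> carrier G" if "i \<in> {0, 1, 2}" for i
    using that unfolding carG X_def by (intro generate.incl) auto
  interpret cover: dihedral_cover G \<rho> p q fst "fst \<circ> snd"
  proof (intro dihedral_cover.intro dihedral_cover_axioms.intro)
    show "group G" by (rule G)
    show "\<rho> ` {0, 1, 2} \<subseteq> carrier G" using \<rho>c by blast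
    show "\<rho> i \<otimes>\<^bsub>G\<^esub> \<rho> i = \<one>\<^bsub>G\<^esub>" if "i \<in> {0, 1, 2}" for i
      using that sq[of "\<rho> i"] by (auto simp: X_def multG oneG)
    show "generate G (\<rho> ` {0, 1, 2}) = carrier G"
      using A.generate_consistent[OF _ sub, of X] by (simp add: G_def X_def generate.incl subsetI)
    show "\<rho> 0 \<otimes>\<^bsub>G\<^esub> \<rho> 2 = \<rho> 2 \<otimes>\<^bsub>G\<^esub> \<rho> 0" by (simp add: multG \<rho> A_def)
    have "\<rho> 0 \<otimes>\<^bsub>A\<^esub> \<rho> 1 = ((0, True) \<otimes>\<^bsub>dihedral p\<^esub> (1, True), (1, True), (((0, True), (0, False)), True))"
      using p q c by (simp add: \<rho>' A_def)
    then show "(\<rho> 0 \<otimes>\<^bsub>G\<^esub> \<rho> 1) [^]\<^bsub>G\<^esub> p = \<one>\<^bsub>G\<^esub>"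
      unfolding multG powG oneG
      using ordp refl_q w[of "(0, True)" p] p by (simp add: A_def nat_pow_DirProd del: mult_dihedral)
    have "\<rho> 1 \<otimes>\<^bsub>A\<^esub> \<rho> 2 = ((1, True), (1, True) \<otimes>\<^bsub>dihedral q\<^esub> (0, True), (((1, True), (0, False)), True))"
      using p q c by (simp add: \<rho>' A_def)
    then show "(\<rho> 1 \<otimes>\<^bsub>G\<^esub> \<rho> 2) [^]\<^bsub>G\<^esub> q = \<one>\<^bsub>G\<^esub>"
      unfolding multG powG oneG
      using ordq refl_p w[of "(1, True)" q] q by (simp add: A_def nat_pow_DirProd del: mult_dihedral)
    show "fst \<in> hom G (dihedral p)" "fst \<circ> snd \<in> hom G (dihedral q)"
      using GA by (auto simp: hom_def multG A_def mult_DirProd')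
  qed (use par in \<open>simp_all add: \<rho>'\<close>)
  have "order A = order (dihedral p) * (order (dihedral q) * order ?W)"
    by (simp add: A_def order_def card_cartesian_product)
  also have "\<dots> = 2 ^ (s + t + n * 2 + 5)"
    by (simp add: order_dihedral order_swap_wreath p_def q_def c_def power_add power_mult_distrib
        flip: power_mult)
  finally have "order A = 2 ^ (s + t + n * 2 + 5)" .
  moreover have "order G = card (generate A X)" by (simp add: order_def carG)
  ultimately have "order G dvd 2 ^ (s + t + n * 2 + 5)"
    using A.lagrange[OF sub] dvd_triv_right by metis
  then obtain N where N: "order G = 2 ^ N" using divides_primepow_nat[OF two_is_prime_nat] by auto
  define z where "z = \<rho> 0 \<otimes>\<^bsub>G\<^esub> (\<rho> 1 \<otimes>\<^bsub>G\<^esub> \<rho> 2 \<otimes>\<^bsub>G\<^esub> \<rho> 1)"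
  have zc: "z \<in> carrier G" using \<rho>c by (simp add: z_def)
  \<comment> \<open>Conjugation by the swap moves the reflection of \<open>\<rho> 2\<close> to the
    axis of \<open>\<rho> 0\<close>. So \<open>c = 2 ^ n\<close> divides the order of
    \<open>G\<close>, which forces \<open>n \<le> N\<close>.\<close>
  obtain u v where z: "z = (u, v, (((0, True) \<otimes>\<^bsub>dihedral c\<^esub> (1, True), (0, False)), False))"
    using c by (simp add: z_def multG \<rho>' A_def)
  have "z [^]\<^bsub>G\<^esub> order G = \<one>\<^bsub>G\<^esub>" using zc by (rule G.pow_order_eq_1)
  then have "((0, True) \<otimes>\<^bsub>dihedral c\<^esub> (1, True)) [^]\<^bsub>dihedral c\<^esub> order G = \<one>\<^bsub>dihedral c\<^esub>"
    unfolding powG oneG z by (simp add: A_def nat_pow_DirProd nat_pow_swap_wreath del: mult_dihedral)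
  then have "c dvd order G"
    using C.pow_eq_id[of "(0, True) \<otimes>\<^bsub>dihedral c\<^esub> (1, True)"] ord_dihedral(1)[of c] c
    by (simp add: carrier_dihedral del: one_dihedral)
  then have "n \<le> N" using N by (simp add: c_def dvd_power_iff_le)
  \<comment> \<open>The quotient by the trivial subgroup only moves the group to a carrier of
    natural numbers.\<close>
  moreover have "{\<one>\<^bsub>G\<^esub>} \<subseteq> kernel G (dihedral p) fst \<inter> kernel G (dihedral q) (fst \<circ> snd)"
    using G.one_closed by (auto simp: kernel_def oneG A_def)
  then obtain G' :: "nat monoid" and \<rho>' f' g' where
    "dihedral_cover G' \<rho>' p q f' g'" "order G' * card {\<one>\<^bsub>G\<^esub>} = order G"
    using cover.quotient[OF p(2) q(2) finG G.one_is_normal] by blast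
  ultimately show ?thesis using N unfolding p_def q_def by fastforce
qed

section \<open>Descent to the prescribed order\<close>

theorem theorem1p1:
  fixes n s t :: nat
  assumes "n \<ge> 10" and "s \<ge> 2" and "t \<ge> 2" and "n - 1 \<ge> s + t"
  shows "\<exists>(G :: nat monoid) \<rho>. string_C_group_rank3 G \<rho> \<and> order G = 2 ^ n \<and>
           schlafli_type G \<rho> = (2 ^ s, 2 ^ t)"
proof -
  define Q where "Q N \<longleftrightarrow> (\<exists>(G :: nat monoid) \<rho> f g.
    dihedral_cover G \<rho> (2 ^ s) (2 ^ t) f g \<and> order G = 2 ^ N)" for N
  obtain N where N: "N \<ge> n" "Q N"
    using large_dihedral_cover[OF assms(2,3), of n] assms(1) unfolding Q_def by fastforce
  have "Q n" using N
  \<comment> \<open>The induction runs downwards from \<open>N\<close> to \<open>n\<close>, halving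
    the order at each step.\<close>
  proof (induction rule: inc_induct)
    case (step m)
    then obtain G :: "nat monoid" and \<rho> f g
      where G: "dihedral_cover G \<rho> (2 ^ s) (2 ^ t) f g" "order G = 2 ^ Suc m"
      unfolding Q_def by auto
    \<comment> \<open>From \<open>m \<ge> n\<close> and \<open>n - 1 \<ge> s + t\<close> follows
      \<open>s + t < m\<close>, so a group of order \<open>2 ^ Suc m\<close> still exceeds the bound
      for a trivial common kernel.\<close>
    have "2 * 2 ^ s * 2 ^ t = (2::nat) ^ Suc (s + t)" by (simp add: power_add)
    also have "\<dots> < 2 ^ Suc m" using step assms by (intro power_strict_increasing) auto
    finally show ?case
      unfolding Q_def using dihedral_cover.descend[OF G] assms by simp
  qed
  then obtain G :: "nat monoid" and \<rho> f g
    where G: "dihedral_cover G \<rho> (2 ^ s) (2 ^ t) f g" "order G = 2 ^ n"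
    unfolding Q_def by auto
  \<comment> \<open>Both rotation orders are at least 4, above the 3 needed for faithfulness on the
    dihedral subgroups.\<close>
  have "(2::nat) ^ 2 \<le> 2 ^ s" "(2::nat) ^ 2 \<le> 2 ^ t"
    using assms by (intro power_increasing; simp)+
  then show ?thesis using dihedral_cover.string_C_group[OF G(1)] G(2) by auto
qed

end
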